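(* Let $\vartheta=\{\theta_1,\dots,\theta_n\}$ be the finite set of filters whose conjunction forms the WHERE clause of a query $Q$, evaluated on a fixed document. Let each filter $\theta_k$ have extraction cost $c_k>0$ and selectivity $p_k\in[0,1]$, and let $c^E_1,\dots,c^E_m\ge 0$ be the extraction costs of the attributes in the SELECT clause. For an order $o$ of the filters (a permutation of $\vartheta$), let $c^F[i]$ and $p[i]$ be the cost and selectivity of the $i$-th filter in $o$, and let the expected query cost be $$\mathcal{C}_Q(o)=\sum_{i=1}^{n}c^{F}[i]\prod_{j=1}^{i-1}p[j]+\Big(\sum_{j=1}^{m}c^{E}_j\Big)\prod_{i=1}^{n}p[i].$$ Define the priority score $\mathrm{priority}(\theta_k)=\dfrac{1-p_k}{c_k}$. Then any order $o^*$ that sorts the filters in descending (non-increasing) order of priority score minimizes the expected query cost, i.e. $\mathcal{C}_Q(o^* )=\min_{o}\mathcal{C}_Q(o)$, where the minimum is over all orders $o$ of $\vartheta$.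
   Context: Filters are predicates on attributes that must be extracted from a document. Evaluating filter $\theta_k$ requires extracting its attribute, at cost $c_k$; its selectivity $p_k$ is the probability that it returns True. A conjunction is evaluated in the given order and stops as soon as some filter returns False; the SELECT attributes are extracted only if all filters return True. The expected cost is the displayed formula, in which the probability that several filters all return True is the product of their selectivities. Empty products equal $1$. *)

theory Defs
  imports Complex_Main "HOL-Combinatorics.Multiset_Permutations"
begin

text \<open>
  Filters are elements of an arbitrary type; an order of a finite set \<open>F\<close> of filters is a list in
  \<^term>\<open>permutations_of_set F\<close>. List positions count from 0, so the filters evaluated before
  position \<open>i\<close> are those at positions \<open>j < i\<close>.
\<close>

definition expected_cost ::
  "('a \<Rightarrow> real) \<Rightarrow> ('a \<Rightarrow> real) \<Rightarrow> nat \<Rightarrow> (nat \<Rightarrow> real) \<Rightarrow> 'a list \<Rightarrow> real" where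
  "expected_cost c p m cE \<sigma> =
     (\<Sum>i<length \<sigma>. c (\<sigma> ! i) * (\<Prod>j<i. p (\<sigma> ! j)))
     + (\<Sum>j=1..m. cE j) * (\<Prod>i<length \<sigma>. p (\<sigma> ! i))"

definition priority :: "('a \<Rightarrow> real) \<Rightarrow> ('a \<Rightarrow> real) \<Rightarrow> 'a \<Rightarrow> real" where
  "priority c p \<theta> = (1 - p \<theta>) / c \<theta>"

end

theory Submission
  imports Defs
begin

text \<open>
  Peeling off the first filter gives the recursion \<open>C (x # xs) = c x + p x * C xs\<close>, where \<open>C []\<close> is
  the SELECT cost. Hence swapping two adjacent filters \<open>y, x\<close> changes the cost by a nonnegative
  factor times \<open>(c x + p x * c y) - (c y + p y * c x)\<close>, which is at most 0 iff \<open>x\<close> has the higher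
  priority. By such swaps a filter of highest priority can be moved to the front of any order, and
  the rest follows by induction.
\<close>

lemma expected_cost_Cons:
  "expected_cost c p m cE (x # xs) = c x + p x * expected_cost c p m cE xs"
  by (simp add: expected_cost_def sum.lessThan_Suc_shift prod.lessThan_Suc_shift
      sum_distrib_left algebra_simps del: sum.lessThan_Suc prod.lessThan_Suc)

text \<open>Both orders reach \<open>zs\<close> with the same weight \<open>p x * p y\<close>, so
  the cost of \<open>zs\<close> cancels. What remains is the priority inequality with denominators
  cleared.\<close>

lemma expected_cost_swap:
  assumes "c x > 0" "c y > 0" "priority c p y \<le> priority c p x"
  shows "expected_cost c p m cE (x # y # zs) \<le> expected_cost c p m cE (y # x # zs)"
proof -
  have "(1 - p y) * c x \<le> (1 - p x) * c y"
    using assms by (simp add: priority_def divide_simps mult.commute)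
  then show ?thesis
    by (simp add: expected_cost_Cons algebra_simps)
qed

lemma expected_cost_move_to_front:
  assumes "c x > 0" "\<And>y. y \<in> set ys \<Longrightarrow> c y > 0 \<and> p y \<ge> 0 \<and> priority c p y \<le> priority c p x"
  shows "expected_cost c p m cE (x # ys @ zs) \<le> expected_cost c p m cE (ys @ x # zs)"
  using assms(2)
proof (induction ys)
  case (Cons y ys)
  have "expected_cost c p m cE (x # y # ys @ zs) \<le> expected_cost c p m cE (y # x # ys @ zs)"
    using Cons.prems assms(1) by (intro expected_cost_swap) auto
  \<comment> \<open>Behind the common first filter \<open>y\<close> this is the induction
    hypothesis, scaled by \<open>p y \<ge> 0\<close>.\<close>
  also have "\<dots> \<le> expected_cost c p m cE (y # ys @ x # zs)"
    unfolding expected_cost_Cons[of _ _ _ _ y]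
    using Cons by (intro add_left_mono mult_left_mono) auto
  finally show ?case by simp
qed simp

text \<open>Comparing multisets lets the induction delete the head of \<open>\<sigma>\<close> from
  both lists and keep the same form of hypothesis.\<close>

lemma expected_cost_sorted_le:
  assumes "sorted_wrt (\<lambda>x y. priority c p x \<ge> priority c p y) \<sigma>"
    and "mset \<tau> = mset \<sigma>"
    and "\<And>x. x \<in> set \<sigma> \<Longrightarrow> c x > 0 \<and> p x \<ge> 0"
  shows "expected_cost c p m cE \<sigma> \<le> expected_cost c p m cE \<tau>"
  using assms
proof (induction \<sigma> arbitrary: \<tau>)
  case (Cons x xs)
  have "x \<in> set \<tau>"
    using mset_eq_setD[OF Cons.prems(2)] by simp
  then obtain ys zs where \<tau>: "\<tau> = ys @ x # zs"
    by (auto dest: split_list)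
  have mset: "mset (ys @ zs) = mset xs"
    using Cons.prems(2) \<tau> by simp
  then have sub: "set ys \<subseteq> set xs"
    using mset_eq_setD by fastforce
  have "expected_cost c p m cE xs \<le> expected_cost c p m cE (ys @ zs)"
    using Cons.prems mset by (intro Cons.IH) auto
  then have "expected_cost c p m cE (x # xs) \<le> expected_cost c p m cE (x # ys @ zs)"
    unfolding expected_cost_Cons using Cons.prems(3) by (intro add_left_mono mult_left_mono) auto
  \<comment> \<open>By sortedness \<open>x\<close> has at least the priority of every filter in
    \<open>xs\<close>, hence of those in \<open>ys\<close>.\<close>
  also have "\<dots> \<le> expected_cost c p m cE \<tau>"
    unfolding \<tau> using Cons.prems sub by (intro expected_cost_move_to_front) auto
  finally show ?case .
qed simp

theorem lemma1:
  fixes F :: "'a set" and c p :: "'a \<Rightarrow> real"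
    and m :: nat and cE :: "nat \<Rightarrow> real" and \<sigma> :: "'a list"
  assumes "finite F"
    and "\<And>\<theta>. \<theta> \<in> F \<Longrightarrow> c \<theta> > 0"
    and "\<And>\<theta>. \<theta> \<in> F \<Longrightarrow> p \<theta> \<in> {0..1}"
    and "\<And>j. j \<in> {1..m} \<Longrightarrow> cE j \<ge> 0"
    and "\<sigma> \<in> permutations_of_set F"
    and "sorted_wrt (\<lambda>\<theta> \<theta>'. priority c p \<theta> \<ge> priority c p \<theta>') \<sigma>"
  shows "expected_cost c p m cE \<sigma> = Min (expected_cost c p m cE ` permutations_of_set F)"
proof (rule Min_eqI[symmetric])
  fix v assume "v \<in> expected_cost c p m cE ` permutations_of_set F"
  then obtain \<tau> where \<tau>: "\<tau> \<in> permutations_of_set F" and v: "v = expected_cost c p m cE \<tau>"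
    by blast
  \<comment> \<open>Both lists are distinct with element set \<open>F\<close>, so their multisets
    agree.\<close>
  have "mset \<tau> = mset \<sigma>"
    using \<tau> assms(5) by (auto simp: permutations_of_set_def set_eq_iff_mset_eq_distinct)
  then show "expected_cost c p m cE \<sigma> \<le> v"
    unfolding v using assms(2,3,5,6)
    by (intro expected_cost_sorted_le) (auto simp: permutations_of_set_def)
qed (use assms(5) in auto)

end
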